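(* Let $p,q_1,q_2,q_3,q_4$ be positive integers with $\gcd(p,q_i)=1$ for $1\le i\le 4$, and let $\beta_1,\beta_2,\beta_3,\beta_4\in\mathbb{R}$. Suppose that $\{S(p/q_i,\beta_i)\}_{i=1}^4$ is a disjoint covering system of rational Beatty sequences. If the moduli $p/q_1,p/q_2,p/q_3,p/q_4$ are distinct, then $p=15$ and $\{q_1,q_2,q_3,q_4\}=\{8,4,2,1\}$.
   Context: For $\alpha,\beta\in\mathbb{R}$ the Beatty sequence with modulus $\alpha$ is the set $S(\alpha,\beta)=\{\lfloor \alpha n+\beta\rfloor : n\in\mathbb{Z}\}$; it is called rational if $\alpha$ is rational. A disjoint covering system of Beatty sequences is a family $\{S(\alpha_i,\beta_i)\}_{i=1}^k$ such that every integer belongs to exactly one of the sets $S(\alpha_i,\beta_i)$. *)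

theory Defs
  imports Complex_Main
begin

definition beatty :: "real \<Rightarrow> real \<Rightarrow> int set" where
  "beatty \<alpha> \<beta> = {\<lfloor>\<alpha> * of_int n + \<beta>\<rfloor> | n :: int. True}"

(* Uniqueness is of the index, not of the set: two equal sets at different
   indices violate disjointness. *)
definition disjoint_covering_system ::
  "nat \<Rightarrow> (nat \<Rightarrow> real) \<Rightarrow> (nat \<Rightarrow> real) \<Rightarrow> bool" where
  "disjoint_covering_system k \<alpha> \<beta> \<longleftrightarrow>
     (\<forall>m :: int. \<exists>!i. i \<in> {1..k} \<and> m \<in> beatty (\<alpha> i) (\<beta> i))"

end

theory Submission
  imports Defs "HOL-Number_Theory.Cong" "HOL-Analysis.Complex_Transcendental"
begin

text \<open>
  Write \<open>b = \<lfloor>q \<beta>\<rfloor>\<close>. An integer \<open>m\<close> lies in \<open>S(p/q, \<beta>)\<close> exactly when \<open>(b - q m) mod p < q\<close>,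
  so modulo \<open>p\<close> the sequence is an arithmetic progression of \<open>q\<close> residues whose difference
  is, up to sign, the inverse of \<open>q\<close> (lemma \<open>sum_over_beatty_period\<close>). Counting residues shows
  that the \<open>q\<^sub>i\<close> add up to \<open>p\<close>. A nontrivial character \<open>m \<mapsto> exp (2 \<pi> i t m / p)\<close>, summed over this
  progression, is a geometric sum of absolute value \<open>\<bar>sin (\<pi> t / p)\<bar> / \<bar>sin (\<pi> s / p)\<bar>\<close>, where
  \<open>q s = t\<close> modulo \<open>p\<close>. Over all residues the character sums to zero, so for a disjoint covering
  system the sums of the individual sequences are the sides of a closed polygon, and no
  side is longer than the others together (lemma \<open>cosecant_polygon_inequality\<close>).

  For \<open>t = q\<^sub>i\<close> this reads \<open>1 / sin (\<pi> / p) \<le> \<Sum>\<^bsub>j \<noteq> i\<^esub> 1 / sin (\<pi> a\<^sub>j / p)\<close>, where \<open>a\<^sub>j \<le> p / 2\<close> is the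
  least absolute residue of \<open>q\<^sub>i / q\<^sub>j\<close>. The numbers \<open>q\<^sub>j\<close> are distinct, even up to sign modulo
  \<open>p\<close>, since any two of them add up to less than \<open>p\<close>; hence for \<open>k = 4\<close> the three \<open>a\<^sub>j\<close> are distinct
  and at least \<open>2\<close>. If they were all at least \<open>3\<close>, the right-hand side would be at most
  about \<open>1/3 + 1/4 + 1/5 < 1\<close> times the left-hand side, and this remains a contradiction for
  every \<open>p \<ge> 11\<close> (lemmas \<open>cosecant_sum_345\<close> and \<open>sum_three_cosecants_less\<close>). So every \<open>q\<^sub>i\<close> is
  twice another \<open>q\<^sub>j\<close>, up to sign and modulo \<open>p\<close> (lemma \<open>exists_doubling_index\<close>).

  The map \<open>i \<mapsto> j\<close> is a permutation of the four indices. A cycle of length \<open>n < 4\<close> would give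
  \<open>2\<^sup>n = \<plusminus>1\<close> modulo \<open>p\<close>, which is impossible for \<open>p \<ge> 11\<close>, so it is a 4-cycle and
  \<open>2\<^sup>4 = \<plusminus>1\<close>, that is, \<open>p = 15\<close> or \<open>p = 17\<close>. Up to a common factor prime to \<open>p\<close>, the sum of the \<open>q\<^sub>i\<close> is
  \<open>1 \<plusminus> 2 \<plusminus> 4 \<plusminus> 8\<close>, a nonzero number of absolute value at most \<open>15\<close>. It is also divisible by \<open>p\<close>,
  and this excludes \<open>17\<close> (lemma \<open>doubling_permutation_numerator\<close>). Finally, \<open>{1, 2, 4, 8}\<close> is the only set of
  four positive integers prime to \<open>15\<close> with sum \<open>15\<close>.
\<close>

section \<open>Rational Beatty sequences as arithmetic progressions of residues\<close>

text \<open>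
  After multiplication by \<open>q\<close> the condition \<open>\<lfloor>p n / q + \<beta>\<rfloor> = m\<close> says that \<open>p n + b - q m\<close> lies in
  \<open>{0..<q}\<close>. Some \<open>n\<close> achieves this if and only if the least nonnegative representative of
  \<open>b - q m\<close> modulo \<open>p\<close> is below \<open>q\<close>.
\<close>

lemma mem_beatty_rational_iff:
  fixes p q :: nat and \<beta> :: real and m :: int
  assumes "p > 0" "q > 0"
  shows "m \<in> beatty (real p / real q) \<beta> \<longleftrightarrow> (\<lfloor>real q * \<beta>\<rfloor> - int q * m) mod int p < int q"
proof -
  define b where "b = \<lfloor>real q * \<beta>\<rfloor>"
  have step: "\<lfloor>real p / real q * of_int n + \<beta>\<rfloor> = m \<longleftrightarrow>
      0 \<le> int p * n + b - int q * m \<and> int p * n + b - int q * m < int q" for n :: int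
  proof -
    have eq: "real p / real q * of_int n + \<beta> = (of_int (int p * n) + real q * \<beta>) / real q"
      using assms by (simp add: field_simps)
    have "\<lfloor>real p / real q * of_int n + \<beta>\<rfloor> = m \<longleftrightarrow>
        of_int (int q * m) \<le> of_int (int p * n) + real q * \<beta> \<and>
        of_int (int p * n) + real q * \<beta> < of_int (int q * m + int q)"
      unfolding eq floor_eq_iff using assms by (simp add: field_simps)
    also have "\<dots> \<longleftrightarrow> int q * m \<le> \<lfloor>of_int (int p * n) + real q * \<beta>\<rfloor> \<and>
        \<lfloor>of_int (int p * n) + real q * \<beta>\<rfloor> < int q * m + int q"
      by (simp only: le_floor_iff floor_less_iff)
    also have "\<lfloor>of_int (int p * n) + real q * \<beta>\<rfloor> = int p * n + b"
      unfolding b_def by (simp only: int_add_floor)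
    finally show ?thesis by linarith
  qed
  have "m \<in> beatty (real p / real q) \<beta> \<longleftrightarrow>
      (\<exists>n. 0 \<le> int p * n + b - int q * m \<and> int p * n + b - int q * m < int q)"
    unfolding beatty_def using step by (simp add: eq_commute[of m])
  also have "\<dots> \<longleftrightarrow> (b - int q * m) mod int p < int q"
  proof
    assume "\<exists>n. 0 \<le> int p * n + b - int q * m \<and> int p * n + b - int q * m < int q"
    then obtain n where n: "0 \<le> int p * n + b - int q * m" "int p * n + b - int q * m < int q"
      by blast
    have "(b - int q * m) mod int p = (int p * n + b - int q * m) mod int p"
      by (simp add: add_diff_eq [symmetric])
    also have "\<dots> \<le> int p * n + b - int q * m"
      using n(1) assms zmod_le_nonneg_dividend by blast
    finally show "(b - int q * m) mod int p < int q" using n(2) by linarith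
  next
    assume a: "(b - int q * m) mod int p < int q"
    let ?n = "- ((b - int q * m) div int p)"
    have "int p * ?n + b - int q * m = (b - int q * m) mod int p"
      by (simp add: minus_mult_div_eq_mod [symmetric])
    then show "\<exists>n. 0 \<le> int p * n + b - int q * m \<and> int p * n + b - int q * m < int q"
      using a assms by (metis of_nat_0_less_iff pos_mod_sign)
  qed
  finally show ?thesis by (simp add: b_def)
qed

text \<open>
  The substitution \<open>j = (b - q m) mod p\<close> has the inverse \<open>m = r (b - j)\<close> modulo \<open>p\<close>, where \<open>r\<close> is an
  inverse of \<open>q\<close>. It turns one period of the Beatty sequence into \<open>j = 0, \<dots>, q - 1\<close>.
\<close>

lemma sum_over_beatty_period:
  fixes p q :: nat and \<beta> :: real and r :: int and f :: "int \<Rightarrow> 'a::comm_monoid_add"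
  assumes "p > 0" "q > 0" "q \<le> p" and r: "[int q * r = 1] (mod int p)"
    and per: "\<And>x. f (x mod int p) = f x"
  shows "(\<Sum>m \<in> {0..<int p} \<inter> beatty (real p / real q) \<beta>. f m)
       = (\<Sum>j<q. f (r * (\<lfloor>real q * \<beta>\<rfloor> - int j)))"
proof -
  define b where "b = \<lfloor>real q * \<beta>\<rfloor>"
  have qrx: "(int q * (r * x)) mod int p = x mod int p" for x
    using cong_scalar_right[OF r, of x] by (simp add: cong_def mult.assoc)
  have mem: "m \<in> beatty (real p / real q) \<beta> \<longleftrightarrow> (b - int q * m) mod int p < int q" for m
    using mem_beatty_rational_iff assms by (simp add: b_def)
  have inv1: "(r * (b - int (nat ((b - int q * m) mod int p)))) mod int p = m"
    if "m \<in> {0..<int p}" for m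
  proof -
    have "int (nat ((b - int q * m) mod int p)) = (b - int q * m) mod int p"
      using assms by simp
    moreover have "[r * (b - (b - int q * m) mod int p) = r * (b - (b - int q * m))] (mod int p)"
      by (intro cong_mult cong_diff cong_refl) simp
    ultimately have "(r * (b - int (nat ((b - int q * m) mod int p)))) mod int p
        = (int q * (r * m)) mod int p"
      by (simp add: cong_def ac_simps)
    also have "\<dots> = m" using that by (simp add: qrx)
    finally show ?thesis .
  qed
  have inv2: "(b - int q * ((r * (b - int j)) mod int p)) mod int p = int j" if "j < q" for j
  proof -
    have "[b - int q * ((r * (b - int j)) mod int p) = b - int q * (r * (b - int j))] (mod int p)"
      by (intro cong_mult cong_diff cong_refl) simp
    also have "[b - int q * (r * (b - int j)) = b - (b - int j)] (mod int p)"
      by (intro cong_diff cong_refl) (simp add: cong_def qrx)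
    finally have "(b - int q * ((r * (b - int j)) mod int p)) mod int p = int j mod int p"
      by (simp add: cong_def)
    also have "\<dots> = int j" using that assms by simp
    finally show ?thesis .
  qed
  show ?thesis unfolding b_def [symmetric]
    by (rule sum.reindex_bij_witness[where i = "\<lambda>j. (r * (b - int j)) mod int p"
          and j = "\<lambda>m. nat ((b - int q * m) mod int p)"])
       (use inv1 inv2 assms in \<open>auto simp: mem per nat_less_iff\<close>,
        metis Int_iff atLeastLessThan_iff inv1 per)
qed

section \<open>Character sums\<close>

definition chi :: "nat \<Rightarrow> int \<Rightarrow> complex" where
  "chi p x = cis (2 * pi * of_int x / real p)"

lemma chi_add: "chi p (x + y) = chi p x * chi p y"
  by (simp add: chi_def cis_mult [symmetric] ring_distribs add_divide_distrib)

lemma chi_power: "chi p x ^ n = chi p (x * int n)"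
  by (simp only: chi_def Complex.DeMoivre of_int_mult of_int_of_nat_eq) (simp add: ac_simps)

lemma norm_chi [simp]: "norm (chi p x) = 1"
  by (simp add: chi_def)

lemma chi_eq_one_if_dvd:
  assumes "p > 0" "int p dvd x" shows "chi p x = 1"
proof -
  from assms obtain k where "x = int p * k" by blast
  then have "2 * pi * of_int x / real p = 2 * pi * of_int k" using assms by simp
  then show ?thesis by (simp only: chi_def cis_multiple_2pi Ints_of_int)
qed

lemma chi_cong:
  assumes "p > 0" "[x = y] (mod int p)" shows "chi p x = chi p y"
proof -
  have "chi p (x - y) = 1" using assms by (intro chi_eq_one_if_dvd) (auto simp: cong_iff_dvd_diff)
  then show ?thesis using chi_add[of p "x - y" y] by simp
qed

lemma norm_one_minus_chi: "norm (1 - chi p x) = 2 * \<bar>sin (pi * of_int x / real p)\<bar>"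
proof -
  define y where "y = pi * of_int x / real p"
  have "chi p x = cis (2 * y)" by (simp add: chi_def y_def ac_simps)
  then have "(norm (1 - chi p x))\<^sup>2 = (1 - cos (2 * y))\<^sup>2 + (sin (2 * y))\<^sup>2"
    by (simp add: cmod_power2)
  also have "\<dots> = (2 * \<bar>sin y\<bar>)\<^sup>2"
    using sin_cos_squared_add[of "2 * y"] cos_double_sin[of y]
    by (simp add: power2_eq_square algebra_simps)
  finally have "norm (1 - chi p x) = 2 * \<bar>sin y\<bar>"
    by (rule power2_eq_imp_eq) auto
  then show ?thesis by (simp only: y_def)
qed

lemma sin_pi_ratio_eq_0_iff:
  assumes "p > 0" shows "sin (pi * of_int x / real p) = 0 \<longleftrightarrow> int p dvd x"
proof
  assume "sin (pi * of_int x / real p) = 0"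
  then obtain i :: int where "pi * of_int x / real p = of_int i * pi"
    by (auto simp: sin_zero_iff_int2)
  then have "real_of_int x = of_int (int p * i)" using assms by (simp add: field_simps)
  then show "int p dvd x" by (simp only: of_int_eq_iff) simp
next
  assume "int p dvd x"
  then have "norm (1 - chi p x) = 0" using chi_eq_one_if_dvd assms by simp
  then show "sin (pi * of_int x / real p) = 0" unfolding norm_one_minus_chi by simp
qed

lemma sum_chi_period_eq_0:
  assumes "p > 0" "\<not> int p dvd t"
  shows "(\<Sum>m\<in>{0..<int p}. chi p (t * m)) = 0"
proof -
  have ne: "chi p t \<noteq> 1"
    using assms sin_pi_ratio_eq_0_iff[of p t] norm_one_minus_chi[of p t] by auto
  have "(\<Sum>m\<in>{0..<int p}. chi p (t * m)) = (\<Sum>m<p. chi p t ^ m)"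
    by (rule sum.reindex_bij_witness[where i = int and j = nat]) (auto simp: chi_power)
  also have "\<dots> = (chi p t ^ p - 1) / (chi p t - 1)" using ne by (rule geometric_sum)
  also have "chi p t ^ p = 1" using assms by (simp add: chi_power chi_eq_one_if_dvd)
  finally show ?thesis by simp
qed

text \<open>
  Along the progression the character takes values in geometric progression with ratio
  \<open>chi p (- s)\<close>. The telescoped sum has numerator \<open>1 - chi p (- s q) = 1 - chi p (- t)\<close>, so the
  length \<open>q\<close> of the progression disappears from the absolute value.
\<close>

lemma norm_beatty_character_sum:
  fixes p q :: nat and \<beta> :: real and s t :: int
  assumes "p > 0" "q > 0" "q \<le> p" "gcd p q = 1" and s: "[int q * s = t] (mod int p)"
  shows "norm (\<Sum>m \<in> {0..<int p} \<inter> beatty (real p / real q) \<beta>. chi p (t * m))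
           * \<bar>sin (pi * of_int s / real p)\<bar> = \<bar>sin (pi * of_int t / real p)\<bar>"
proof -
  have "coprime (int q) (int p)"
    using assms by (metis coprime_iff_gcd_eq_1 coprime_int_iff gcd.commute)
  then obtain r where r: "[int q * r = 1] (mod int p)"
    using cong_solve_coprime_int by blast
  have tr: "[t * r = s] (mod int p)"
  proof -
    have "[t * r = int q * s * r] (mod int p)" by (metis cong_scalar_right cong_sym s)
    also have "[int q * s * r = s] (mod int p)"
      using cong_scalar_right[OF r, of s] by (simp add: ac_simps)
    finally show ?thesis .
  qed
  define b where "b = \<lfloor>real q * \<beta>\<rfloor>"
  have "(\<Sum>m \<in> {0..<int p} \<inter> beatty (real p / real q) \<beta>. chi p (t * m))
      = (\<Sum>j<q. chi p (t * (r * (b - int j))))"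
    unfolding b_def using assms(1-3) r
    by (intro sum_over_beatty_period chi_cong) (auto simp: cong_def mod_mult_right_eq)
  also have "\<dots> = (\<Sum>j<q. chi p (s * b) * chi p (- s) ^ j)"
  proof (rule sum.cong)
    fix j
    have "[t * (r * (b - int j)) = s * (b - int j)] (mod int p)"
      using cong_scalar_right[OF tr, of "b - int j"] by (simp add: mult.assoc)
    then show "chi p (t * (r * (b - int j))) = chi p (s * b) * chi p (- s) ^ j"
      using assms(1) by (subst chi_cong) (auto simp: chi_power chi_add [symmetric] algebra_simps)
  qed simp
  finally have sum_eq: "norm (\<Sum>m \<in> {0..<int p} \<inter> beatty (real p / real q) \<beta>. chi p (t * m))
      = norm (\<Sum>j<q. chi p (- s) ^ j)"
    by (simp add: sum_distrib_left [symmetric] norm_mult)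
  have "norm (\<Sum>j<q. chi p (- s) ^ j) * norm (1 - chi p (- s)) = norm (1 - chi p (- s) ^ q)"
    unfolding norm_mult [symmetric] by (metis mult.commute one_diff_power_eq)
  also have "chi p (- s) ^ q = chi p (- t)"
    unfolding chi_power using assms(1) s
    by (intro chi_cong) (auto simp: mult.commute cong_minus_minus_iff)
  finally show ?thesis unfolding norm_one_minus_chi sum_eq by simp
qed

section \<open>Consequences of the covering property\<close>

text \<open>
  Applied to the constant \<open>1\<close> this gives the sum of the numbers \<open>q\<^sub>i\<close>, applied to a character the closed
  polygon.
\<close>

lemma sum_over_disjoint_covering:
  fixes f :: "int \<Rightarrow> 'a::comm_semiring_1"
  assumes dcs: "disjoint_covering_system k \<alpha> \<beta>" and "finite A"
  shows "(\<Sum>i\<in>{1..k}. \<Sum>m \<in> A \<inter> beatty (\<alpha> i) (\<beta> i). f m) = (\<Sum>m\<in>A. f m)"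
proof -
  have "(\<Sum>i\<in>{1..k}. \<Sum>m \<in> A \<inter> beatty (\<alpha> i) (\<beta> i). f m)
      = (\<Sum>m\<in>A. \<Sum>i\<in>{1..k}. if m \<in> beatty (\<alpha> i) (\<beta> i) then f m else 0)"
    using \<open>finite A\<close> by (subst sum.swap) (simp add: sum.inter_restrict)
  also have "\<dots> = (\<Sum>m\<in>A. f m)"
  proof (rule sum.cong)
    fix m
    obtain i where i: "i \<in> {1..k} \<and> m \<in> beatty (\<alpha> i) (\<beta> i)"
      and uniq: "\<And>j. j \<in> {1..k} \<and> m \<in> beatty (\<alpha> j) (\<beta> j) \<Longrightarrow> j = i"
      using dcs unfolding disjoint_covering_system_def by metis
    have "(\<Sum>j\<in>{1..k}. if m \<in> beatty (\<alpha> j) (\<beta> j) then f m else 0)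
        = (\<Sum>j\<in>{1..k}. if j = i then f m else 0)"
      using i uniq by (intro sum.cong refl if_cong) metis
    then show "(\<Sum>j\<in>{1..k}. if m \<in> beatty (\<alpha> j) (\<beta> j) then f m else 0) = f m"
      using i by simp
  qed simp
  finally show ?thesis .
qed

text \<open>
  A modulus \<open>p / q \<le> 1\<close> would give a sequence that covers every integer, leaving no room for a
  second one.
\<close>

lemma numerator_bound:
  fixes p k :: nat and q :: "nat \<Rightarrow> nat"
  assumes "p > 0" and qpos: "\<And>i. i \<in> {1..k} \<Longrightarrow> q i > 0" and "k \<ge> 2"
    and dcs: "disjoint_covering_system k (\<lambda>i. real p / real (q i)) \<beta>" and i: "i \<in> {1..k}"
  shows "q i < p"
proof (rule ccontr)
  assume "\<not> q i < p"
  then have all: "m \<in> beatty (real p / real (q i)) (\<beta> i)" for m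
    using mem_beatty_rational_iff[of p "q i" m "\<beta> i"] qpos[OF i] \<open>p > 0\<close>
    by (smt (verit) Euclidean_Rings.pos_mod_bound of_nat_0_less_iff of_nat_less_iff)
  obtain j where j: "j \<in> {1..k}" "j \<noteq> i"
    using i \<open>k \<ge> 2\<close> by (metis One_nat_def Suc_1 Suc_le_eq atLeastAtMost_iff le_trans less_irrefl nat_le_linear)
  define m where "m = \<lfloor>\<beta> j\<rfloor>"
  have "m \<in> beatty (real p / real (q j)) (\<beta> j)"
    unfolding beatty_def m_def by (rule CollectI, rule exI[of _ 0]) simp
  with all[of m] i j dcs show False unfolding disjoint_covering_system_def by metis
qed

lemma sum_numerators:
  fixes p k :: nat and q :: "nat \<Rightarrow> nat"
  assumes "p > 0" and qpos: "\<And>i. i \<in> {1..k} \<Longrightarrow> q i > 0"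
    and qle: "\<And>i. i \<in> {1..k} \<Longrightarrow> q i \<le> p"
    and cop: "\<And>i. i \<in> {1..k} \<Longrightarrow> gcd p (q i) = 1"
    and dcs: "disjoint_covering_system k (\<lambda>i. real p / real (q i)) \<beta>"
  shows "(\<Sum>i\<in>{1..k}. q i) = p"
proof -
  have "card ({0..<int p} \<inter> beatty (real p / real (q i)) (\<beta> i)) = q i" if i: "i \<in> {1..k}" for i
  proof -
    have "coprime (int (q i)) (int p)"
      using cop[OF i] by (metis coprime_iff_gcd_eq_1 coprime_int_iff gcd.commute)
    then obtain r where "[int (q i) * r = 1] (mod int p)"
      using cong_solve_coprime_int by blast
    then show ?thesis
      using sum_over_beatty_period[of p "q i" r "\<lambda>_. 1::nat" "\<beta> i"] qpos[OF i] qle[OF i] \<open>p > 0\<close>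
      by simp
  qed
  then show ?thesis
    using sum_over_disjoint_covering[OF dcs, of "{0..<int p}" "\<lambda>_. 1::nat"] by simp
qed

text \<open>
  The character sums of the \<open>k\<close> sequences add up to zero, so the triangle inequality bounds one
  of them by the others; the common factor \<open>\<bar>sin (\<pi> t / p)\<bar>\<close> is then cancelled.
\<close>

lemma cosecant_polygon_inequality:
  fixes p k :: nat and q :: "nat \<Rightarrow> nat" and s :: "nat \<Rightarrow> int"
  assumes "p > 0" and qpos: "\<And>i. i \<in> {1..k} \<Longrightarrow> q i > 0"
    and qle: "\<And>i. i \<in> {1..k} \<Longrightarrow> q i \<le> p"
    and cop: "\<And>i. i \<in> {1..k} \<Longrightarrow> gcd p (q i) = 1"
    and dcs: "disjoint_covering_system k (\<lambda>i. real p / real (q i)) \<beta>"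
    and t: "\<not> int p dvd t"
    and s: "\<And>j. j \<in> {1..k} \<Longrightarrow> [int (q j) * s j = t] (mod int p)"
    and i: "i \<in> {1..k}"
  shows "1 / \<bar>sin (pi * of_int (s i) / real p)\<bar>
       \<le> (\<Sum>j\<in>{1..k} - {i}. 1 / \<bar>sin (pi * of_int (s j) / real p)\<bar>)"
proof -
  define F where "F j = (\<Sum>m \<in> {0..<int p} \<inter> beatty (real p / real (q j)) (\<beta> j). chi p (t * m))" for j
  define T where "T = \<bar>sin (pi * of_int t / real p)\<bar>"
  have T: "T > 0" using sin_pi_ratio_eq_0_iff[OF \<open>p > 0\<close>] t by (simp add: T_def)
  have F: "norm (F j) = T * (1 / \<bar>sin (pi * of_int (s j) / real p)\<bar>)" if j: "j \<in> {1..k}" for j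
  proof -
    have "norm (F j) * \<bar>sin (pi * of_int (s j) / real p)\<bar> = T"
      unfolding F_def T_def using norm_beatty_character_sum[OF \<open>p > 0\<close> qpos qle cop s] j by blast
    then show ?thesis using T by (auto simp: field_simps)
  qed
  have "(\<Sum>j\<in>{1..k}. F j) = 0"
    unfolding F_def using sum_chi_period_eq_0[OF \<open>p > 0\<close> t]
    by (subst sum_over_disjoint_covering[OF dcs]) simp_all
  then have "F i = - (\<Sum>j\<in>{1..k} - {i}. F j)"
    using i by (simp add: sum.remove[of _ i] eq_neg_iff_add_eq_0)
  then have "norm (F i) \<le> (\<Sum>j\<in>{1..k} - {i}. norm (F j))"
    by (simp add: norm_sum)
  also have "\<dots> = (\<Sum>j\<in>{1..k} - {i}. T * (1 / \<bar>sin (pi * of_int (s j) / real p)\<bar>))"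
    by (intro sum.cong F) auto
  also have "\<dots> = T * (\<Sum>j\<in>{1..k} - {i}. 1 / \<bar>sin (pi * of_int (s j) / real p)\<bar>)"
    by (simp add: sum_distrib_left)
  finally show ?thesis unfolding F[OF i] using T by (simp only: mult_le_cancel_left_pos)
qed

section \<open>Congruence up to sign\<close>

text \<open>
  The quantity \<open>\<bar>sin (\<pi> x / p)\<bar>\<close> depends on \<open>x\<close> only up to sign and modulo \<open>p\<close>.
\<close>

definition pm_cong :: "nat \<Rightarrow> int \<Rightarrow> int \<Rightarrow> bool" where
  "pm_cong p x y \<longleftrightarrow> [x = y] (mod int p) \<or> [x = - y] (mod int p)"

lemma pm_cong_iff_sign: "pm_cong p x y \<longleftrightarrow> (\<exists>e\<in>{1, -1}. [x = e * y] (mod int p))"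
  by (auto simp: pm_cong_def)

lemma pm_cong_sym: "pm_cong p x y \<Longrightarrow> pm_cong p y x"
  unfolding pm_cong_def by (metis cong_minus_minus_iff cong_sym minus_minus)

lemma pm_cong_trans: "pm_cong p x y \<Longrightarrow> pm_cong p y z \<Longrightarrow> pm_cong p x z"
  unfolding pm_cong_def by (metis cong_minus_minus_iff cong_trans minus_minus)

lemma pm_cong_mult_left: "pm_cong p x y \<Longrightarrow> pm_cong p (c * x) (c * y)"
  unfolding pm_cong_def using cong_scalar_left[of x _ "int p" c] by fastforce

lemma pm_cong_cancel:
  assumes "coprime c (int p)" "pm_cong p (x * c) (y * c)"
  shows "pm_cong p x y"
  using assms cong_mult_rcancel[of c "int p" x y] cong_mult_rcancel[of c "int p" x "- y"]
  by (auto simp: pm_cong_def)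

lemma not_pm_cong_small:
  assumes "0 < x" "0 < y" "x \<noteq> y" "x + y < int p"
  shows "\<not> pm_cong p x y"
proof
  assume "pm_cong p x y"
  then have "int p dvd x - y \<or> int p dvd x + y"
    by (auto simp: pm_cong_def cong_iff_dvd_diff)
  then show False
    using assms zdvd_imp_le[of "int p" "x + y"] zdvd_imp_le[of "int p" "\<bar>x - y\<bar>"] by auto
qed

lemma abs_sin_pm_cong:
  assumes "p > 0" "pm_cong p x y"
  shows "\<bar>sin (pi * of_int x / real p)\<bar> = \<bar>sin (pi * of_int y / real p)\<bar>"
proof -
  have "norm (1 - chi p x) = norm (1 - chi p y)"
    using assms(2) unfolding pm_cong_def
  proof
    assume "[x = y] (mod int p)"
    then show ?thesis by (simp add: chi_cong[OF \<open>p > 0\<close>])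
  next
    assume "[x = - y] (mod int p)"
    then have "chi p x = chi p (- y)" by (rule chi_cong[OF \<open>p > 0\<close>])
    then show ?thesis by (simp add: norm_one_minus_chi)
  qed
  then show ?thesis unfolding norm_one_minus_chi by simp
qed

lemma least_absolute_residue:
  fixes p :: nat and x :: int
  assumes "p > 0" "\<not> int p dvd x"
  obtains a :: nat where "0 < a" "2 * a \<le> p" "pm_cong p x (int a)"
proof -
  define y where "y = x mod int p"
  have "y \<noteq> 0" using assms by (simp add: y_def dvd_eq_mod_eq_0)
  moreover have "0 \<le> y" using assms by (simp add: y_def)
  ultimately have "0 < y" by linarith
  have "y < int p" "[x = y] (mod int p)" using assms by (simp_all add: y_def cong_def)
  note y = \<open>0 < y\<close> this
  show thesis
  proof (cases "2 * y \<le> int p")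
    case True
    then show thesis using y by (intro that[of "nat y"]) (auto simp: pm_cong_def)
  next
    case False
    have "[x = - (int p - y)] (mod int p)" using y(3) by (simp add: cong_def)
    then show thesis using False y by (intro that[of "nat (int p - y)"]) (auto simp: pm_cong_def)
  qed
qed

section \<open>A cosecant estimate\<close>

text \<open>
  With \<open>u = sin\<^sup>2 \<theta>\<close> the multiple angle formulas give
  \<open>sin (3 \<theta>) / sin \<theta> = 3 - 4 u\<close>, \<open>sin (4 \<theta>) / sin \<theta> = 4 cos \<theta> (1 - 2 u)\<close> and
  \<open>sin (5 \<theta>) / sin \<theta> = 5 - 20 u + 16 u\<^sup>2\<close>. Since \<open>u \<le> \<theta>\<^sup>2\<close> is small, the sum of the
  reciprocals stays below \<open>1\<close>. The estimate fails for \<open>\<theta> = \<pi> / 10\<close>.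
\<close>

lemma cosecant_sum_345:
  fixes \<theta> :: real
  assumes "0 < \<theta>" "\<theta> \<le> pi / 11"
  shows "1 / sin (3 * \<theta>) + 1 / sin (4 * \<theta>) + 1 / sin (5 * \<theta>) < 1 / sin \<theta>"
proof -
  define S where "S = sin \<theta>"
  define C where "C = cos \<theta>"
  define u where "u = S\<^sup>2"
  (* The bounds below rest on (pi / 11)^2 < 0.0816; the three quotients are then at least
     2.67, 3.07 and 3.36, and 1/2.67 + 1/3.07 + 1/3.36 < 0.998. *)
  have "pi \<le> 3.1416" using pi_approx by simp
  then have th: "\<theta> \<le> 0.2856" using assms by simp
  have S: "S > 0" unfolding S_def using assms pi_gt_zero by (intro sin_gt_zero) auto
  have "S \<le> \<theta>" unfolding S_def using assms by (intro sin_x_le_x) auto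
  then have u: "0 < u" "u \<le> 0.0816"
    using S th power_mono[of S "0.2856" 2] by (auto simp: u_def power2_eq_square)
  have C2: "C\<^sup>2 = 1 - u" unfolding C_def u_def S_def by (simp add: cos_squared_eq)
  have C: "C > 0" unfolding C_def using assms pi_gt_zero by (intro cos_gt_zero_pi) auto
  then have "C \<le> 1" by (simp add: C_def)
  then have Cu: "C \<ge> 1 - u" using C C2 by (metis mult_left_le less_imp_le power2_eq_square)
  have s2: "sin (2 * \<theta>) = 2 * S * C" and c2: "cos (2 * \<theta>) = 1 - 2 * u"
    by (simp_all add: sin_double cos_double_sin S_def C_def u_def)
  have s3: "sin (3 * \<theta>) = S * (3 - 4 * u)"
  proof -
    have "sin (3 * \<theta>) = sin (2 * \<theta> + \<theta>)" by simp
    also have "\<dots> = 2 * S * C * C + (1 - 2 * u) * S"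
      unfolding sin_add s2 c2 by (simp add: S_def C_def)
    also have "\<dots> = 2 * S * C\<^sup>2 + (1 - 2 * u) * S" by (simp add: power2_eq_square)
    finally show ?thesis unfolding C2 by (simp add: algebra_simps)
  qed
  have s4: "sin (4 * \<theta>) = S * (4 * C * (1 - 2 * u))"
    using sin_double[of "2 * \<theta>"] by (simp add: s2 c2)
  have c3: "cos (3 * \<theta>) = C * (1 - 4 * u)"
  proof -
    have "cos (3 * \<theta>) = cos (2 * \<theta> + \<theta>)" by simp
    also have "\<dots> = (1 - 2 * u) * C - 2 * C * u"
      unfolding cos_add s2 c2 by (simp add: S_def C_def u_def power2_eq_square)
    finally show ?thesis by (simp add: algebra_simps)
  qed
  have s5: "sin (5 * \<theta>) = S * (5 - 20 * u + 16 * u\<^sup>2)"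
  proof -
    have "sin (5 * \<theta>) = sin (3 * \<theta> + 2 * \<theta>)" by simp
    also have "\<dots> = S * (3 - 4 * u) * (1 - 2 * u) + 2 * S * (1 - 4 * u) * C\<^sup>2"
      unfolding sin_add s2 c2 s3 c3 by (simp add: power2_eq_square)
    finally show ?thesis unfolding C2 by (simp add: power2_eq_square algebra_simps)
  qed
  have b3: "3 - 4 * u \<ge> 2.67" using u by simp
  have "(1 - u) * (1 - 2 * u) \<ge> 0.9184 * 0.8368" using u by (intro mult_mono) auto
  moreover have "C * (1 - 2 * u) \<ge> (1 - u) * (1 - 2 * u)"
    using Cu u by (intro mult_right_mono) auto
  ultimately have b4: "4 * C * (1 - 2 * u) \<ge> 3.07" by simp
  have b5: "5 - 20 * u + 16 * u\<^sup>2 \<ge> 3.36" using u by (simp add: add_increasing2)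
  have "1 / (3 - 4 * u) + 1 / (4 * C * (1 - 2 * u)) + 1 / (5 - 20 * u + 16 * u\<^sup>2)
      \<le> 1 / 2.67 + 1 / 3.07 + 1 / 3.36"
    using b3 b4 b5 by (intro add_mono frac_le) auto
  also have "\<dots> < 1" by simp
  finally have "(1 / (3 - 4 * u) + 1 / (4 * C * (1 - 2 * u)) + 1 / (5 - 20 * u + 16 * u\<^sup>2)) / S < 1 / S"
    using S by (intro divide_strict_right_mono)
  then show ?thesis unfolding s3 s4 s5 S_def [symmetric] using S by (simp add: add_divide_distrib ac_simps)
qed


text \<open>
  The cosecant decreases on \<open>(0, \<pi> / 2]\<close>, so the sum is largest for \<open>A = {3, 4, 5}\<close>.
\<close>

lemma sum_three_cosecants_less:
  fixes p :: nat and A :: "nat set"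
  assumes "p \<ge> 11" "card A = 3" and A: "\<And>a. a \<in> A \<Longrightarrow> 3 \<le> a \<and> 2 * a \<le> p"
  shows "(\<Sum>a\<in>A. 1 / sin (pi * real a / real p)) < 1 / sin (pi / real p)"
proof -
  define \<theta> where "\<theta> = pi / real p"
  have \<theta>: "0 < \<theta>" "\<theta> \<le> pi / 11"
    using assms(1) frac_le[of pi pi 11 "real p"] by (simp_all add: \<theta>_def)
  have mono: "1 / sin (pi * real a / real p) \<le> 1 / sin (real b * \<theta>)"
    if "0 < b" "b \<le> a" "2 * a \<le> p" for a b :: nat
  proof -
    have eq: "pi * real a / real p = real a * \<theta>" by (simp add: \<theta>_def)
    have le: "real b * \<theta> \<le> real a * \<theta>" using that \<theta> by simp
    have "real (2 * a) * pi \<le> real p * pi" using that by (intro mult_right_mono) auto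
    then have half: "real a * \<theta> \<le> pi / 2" using assms(1) by (simp add: \<theta>_def field_simps)
    have pos: "0 < real b * \<theta>" using that \<theta> by simp
    have "sin (real b * \<theta>) > 0" using pos le half pi_gt_zero by (intro sin_gt_zero) linarith+
    moreover have "sin (real b * \<theta>) \<le> sin (real a * \<theta>)"
      using pos le half by (intro sin_monotone_2pi_le) linarith+
    ultimately show ?thesis unfolding eq by (intro frac_le) auto
  qed
  obtain a b c where abc: "A = {a, b, c}" "a < b" "b < c"
  proof -
    obtain x y z where "A = {x, y, z}" "x \<noteq> y" "y \<noteq> z" "x \<noteq> z"
      using \<open>card A = 3\<close> by (auto simp: card_3_iff)
    then show thesis
      using that[of x y z] that[of x z y] that[of y x z] that[of y z x] that[of z x y] that[of z y x]
      by (metis insert_commute nat_neq_iff)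
  qed
  have "(\<Sum>a\<in>A. 1 / sin (pi * real a / real p))
      = 1 / sin (pi * real a / real p) + 1 / sin (pi * real b / real p) + 1 / sin (pi * real c / real p)"
    using abc by simp
  also have "\<dots> \<le> 1 / sin (real 3 * \<theta>) + 1 / sin (real 4 * \<theta>) + 1 / sin (real 5 * \<theta>)"
    using abc A[of a] A[of b] A[of c] by (intro add_mono mono) auto
  also have "\<dots> < 1 / sin \<theta>" using cosecant_sum_345[OF \<theta>] by simp
  finally show ?thesis by (simp add: \<theta>_def)
qed

section \<open>Four Beatty sequences\<close>

text \<open>
  The polygon inequality with \<open>t = q i\<close> involves the residues \<open>q i / q j\<close>, whose least absolute
  representatives \<open>a j\<close> are distinct and different from \<open>1\<close>. The cosecant estimate then forces one
  of them to be \<open>2\<close>.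
\<close>

lemma exists_doubling_index:
  fixes p :: nat and q :: "nat \<Rightarrow> nat"
  assumes p: "p \<ge> 11" and qpos: "\<And>i. i \<in> {1..4} \<Longrightarrow> q i > 0"
    and cop: "\<And>i. i \<in> {1..4} \<Longrightarrow> gcd p (q i) = 1"
    and dcs: "disjoint_covering_system 4 (\<lambda>i. real p / real (q i)) \<beta>"
    and sep: "\<And>i j. i \<in> {1..4} \<Longrightarrow> j \<in> {1..4} \<Longrightarrow> i \<noteq> j \<Longrightarrow> \<not> pm_cong p (q i) (q j)"
    and i: "i \<in> {1..4}"
  shows "\<exists>j\<in>{1..4} - {i}. pm_cong p (q i) (2 * int (q j))"
proof (rule ccontr)
  assume no_double: "\<not> ?thesis"
  have "p > 0" using p by simp
  have copi: "coprime (int (q j)) (int p)" if "j \<in> {1..4}" for j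
    using cop[OF that] by (metis coprime_iff_gcd_eq_1 coprime_int_iff gcd.commute)
  have ndvd: "\<not> int p dvd int (q i)"
    using cop[OF i] p by (auto simp: gcd_nat.absorb1)
  have "\<exists>s. [int (q j) * s = int (q i)] (mod int p)" if "j \<in> {1..4}" for j
    using cong_solve_coprime_int[OF copi[OF that]] cong_scalar_right mult.assoc mult_1 by metis
  then obtain s0 where s0: "\<And>j. j \<in> {1..4} \<Longrightarrow> [int (q j) * s0 j = int (q i)] (mod int p)"
    by metis
  (* Any solution is congruent to 1 at the index i; choosing 1 itself makes the long side
     of the polygon equal to 1 / sin (pi / p). *)
  define s where "s = s0(i := 1)"
  have s: "[int (q j) * s j = int (q i)] (mod int p)" if "j \<in> {1..4}" for j
    using s0[OF that] by (simp add: s_def)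
  have "\<not> int p dvd s j" if "j \<in> {1..4}" for j
    using s[OF that] ndvd cong_dvd_iff dvd_mult by (metis cong_sym cong_dvd_modulus cong_def dvd_eq_mod_eq_0)
  then have "\<exists>a::nat. 0 < a \<and> 2 * a \<le> p \<and> pm_cong p (s j) (int a)" if "j \<in> {1..4}" for j
    using least_absolute_residue[OF \<open>p > 0\<close>] that by metis
  then obtain a :: "nat \<Rightarrow> nat" where a: "\<And>j. j \<in> {1..4} \<Longrightarrow> 0 < a j \<and> 2 * a j \<le> p \<and> pm_cong p (s j) (int (a j))"
    by metis
  have qa: "pm_cong p (q i) (int (q j) * int (a j))" if j: "j \<in> {1..4}" for j
  proof -
    have "pm_cong p (q i) (int (q j) * s j)"
      using s[OF j] by (simp add: pm_cong_def cong_sym)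
    then show ?thesis using a[OF j] pm_cong_mult_left pm_cong_trans by blast
  qed
  let ?J = "{1..4} - {i}"
  have a_ge: "3 \<le> a j" if j: "j \<in> ?J" for j
  proof -
    have "a j \<noteq> 1" using qa[of j] sep[of i j] i j by auto
    moreover have "a j \<noteq> 2"
    proof
      assume "a j = 2"
      then have "pm_cong p (q i) (2 * int (q j))" using qa[of j] j by (simp add: mult.commute)
      then show False using no_double j by blast
    qed
    ultimately show ?thesis using a[of j] j by simp
  qed
  have "inj_on a ?J"
  proof (rule inj_onI, rule ccontr)
    fix j l assume jl: "j \<in> ?J" "l \<in> ?J" "a j = a l" "j \<noteq> l"
    have "coprime (int (a j)) (int p)"
    proof -
      have "pm_cong p (q i) (int (q j) * int (a j))" using qa jl by blast
      then obtain e where "[int (q i) = e * (int (q j) * int (a j))] (mod int p)"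
        unfolding pm_cong_iff_sign by blast
      then have "coprime (e * (int (q j) * int (a j))) (int p)"
        using copi[OF i] by (rule cong_imp_coprime)
      then show ?thesis by (simp add: coprime_mult_left_iff)
    qed
    moreover have "pm_cong p (int (q j) * int (a j)) (int (q l) * int (a j))"
      using qa[of j] qa[of l] jl pm_cong_sym pm_cong_trans by (metis DiffD1)
    ultimately have "pm_cong p (q j) (q l)" by (rule pm_cong_cancel)
    then show False using sep jl by blast
  qed
  then have card: "card (a ` ?J) = 3" using i by (simp add: card_image)
  have qle: "q j \<le> p" if "j \<in> {1..4}" for j
    using numerator_bound[OF \<open>p > 0\<close> qpos _ dcs that] by simp
  have "1 / sin (pi / real p) = 1 / \<bar>sin (pi * of_int (s i) / real p)\<bar>"
  proof -
    have "pi / real p \<le> pi / 1" using p by (intro divide_left_mono) auto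
    then have "sin (pi / real p) \<ge> 0" using p by (intro sin_ge_zero) auto
    then show ?thesis by (simp add: s_def)
  qed
  also have "\<dots> \<le> (\<Sum>j\<in>?J. 1 / \<bar>sin (pi * of_int (s j) / real p)\<bar>)"
    by (rule cosecant_polygon_inequality[OF \<open>p > 0\<close> qpos qle cop dcs ndvd s i])
  also have "\<dots> = (\<Sum>j\<in>?J. 1 / sin (pi * real (a j) / real p))"
  proof (rule sum.cong)
    fix j assume j: "j \<in> ?J"
    then have "\<bar>sin (pi * of_int (s j) / real p)\<bar> = \<bar>sin (pi * real (a j) / real p)\<bar>"
      using abs_sin_pm_cong[OF \<open>p > 0\<close>, of "s j" "int (a j)"] a[of j] by simp
    moreover have "sin (pi * real (a j) / real p) \<ge> 0"
    proof -
      have "pi * real (a j) \<le> pi * real p" using a[of j] j by (intro mult_left_mono) auto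
      then show ?thesis using \<open>p > 0\<close> by (intro sin_ge_zero) (auto simp: field_simps)
    qed
    ultimately show "1 / \<bar>sin (pi * of_int (s j) / real p)\<bar> = 1 / sin (pi * real (a j) / real p)"
      by simp
  qed simp
  also have "\<dots> = (\<Sum>b\<in>a ` ?J. 1 / sin (pi * real b / real p))"
    using \<open>inj_on a ?J\<close> by (simp add: sum.reindex)
  also have "\<dots> < 1 / sin (pi / real p)"
    using a a_ge by (intro sum_three_cosecants_less p card) auto
  finally show False by simp
qed

text \<open>
  A cycle of length \<open>n\<close> of \<open>f\<close> gives \<open>2\<^sup>n = \<plusminus>1\<close> modulo \<open>p\<close>, because the \<open>q i\<close> can be cancelled. This
  excludes the lengths below \<open>4\<close> and leaves \<open>p dvd 15\<close> or \<open>p dvd 17\<close>. Expressing all terms of the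
  sum \<open>p\<close> through the last one shows that \<open>p\<close> divides an odd number \<open>1 \<plusminus> 2 \<plusminus> 4 \<plusminus> 8\<close>.
\<close>

lemma doubling_permutation_numerator:
  fixes p :: nat and q f :: "nat \<Rightarrow> nat"
  assumes p: "p \<ge> 11"
    and cop: "\<And>i. i \<in> {1..4} \<Longrightarrow> coprime (int (q i)) (int p)"
    and total: "(\<Sum>i\<in>{1..4}. q i) = p"
    and sep: "\<And>i j. i \<in> {1..4} \<Longrightarrow> j \<in> {1..4} \<Longrightarrow> i \<noteq> j \<Longrightarrow> \<not> pm_cong p (q i) (q j)"
    and f: "\<And>i. i \<in> {1..4} \<Longrightarrow> f i \<in> {1..4} - {i} \<and> pm_cong p (q i) (2 * int (q (f i)))"
  shows "p = 15"
proof -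
  have inj: "i = j" if "i \<in> {1..4}" "j \<in> {1..4}" "f i = f j" for i j
    using f[of i] f[of j] sep[of i j] that pm_cong_sym pm_cong_trans by metis
  have no_small: "\<not> pm_cong p (q i) (c * q i)" if "i \<in> {1..4}" "1 < c" "c < 10" for i and c :: int
  proof
    assume "pm_cong p (q i) (c * q i)"
    then have "pm_cong p 1 c" using pm_cong_cancel[OF cop[OF that(1)], of 1 c] by simp
    then show False using not_pm_cong_small[of 1 c p] that p by simp
  qed
  define a b c d where "a = (1::nat)" and "b = f a" and "c = f b" and "d = f c"
  have mem: "a \<in> {1..4}" "b \<in> {1..4}" "c \<in> {1..4}" "d \<in> {1..4}"
    using f by (auto simp: a_def b_def c_def d_def)
  have ab: "pm_cong p (q a) (2 * int (q b))" and bc: "pm_cong p (q b) (2 * int (q c))"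
    and cd: "pm_cong p (q c) (2 * int (q d))" and de: "pm_cong p (q d) (2 * int (q (f d)))"
    using f mem b_def c_def d_def by auto
  have ac: "pm_cong p (q a) (4 * int (q c))" and bd: "pm_cong p (q b) (4 * int (q d))"
    using pm_cong_trans[OF ab pm_cong_mult_left[OF bc, of 2]]
      pm_cong_trans[OF bc pm_cong_mult_left[OF cd, of 2]] by simp_all
  have ad: "pm_cong p (q a) (8 * int (q d))"
    using pm_cong_trans[OF ab pm_cong_mult_left[OF bd, of 2]] by simp
  have ae: "pm_cong p (q a) (16 * int (q (f d)))"
    using pm_cong_trans[OF ad pm_cong_mult_left[OF de, of 8]] by simp
  have "b \<noteq> a" "c \<noteq> b" "d \<noteq> c" using f mem b_def c_def d_def by auto
  moreover have "c \<noteq> a" using no_small[of a 4] ac mem by auto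
  moreover have "d \<noteq> a" using no_small[of a 8] ad mem by auto
  moreover have "d \<noteq> b" using inj[of c a] \<open>c \<noteq> a\<close> mem by (auto simp: b_def d_def)
  ultimately have distinct: "distinct [a, b, c, d]" by auto
  have all: "{1..4} = {a, b, c, d}"
    by (rule sym, rule card_subset_eq) (use mem distinct in auto)
  have "f d \<noteq> f a" "f d \<noteq> f b" using inj[of d a] inj[of d b] mem distinct by auto
  then have "f d \<noteq> b" "f d \<noteq> c" unfolding b_def c_def .
  moreover have "f d \<in> {a, b, c, d} - {d}" using f[OF mem(4)] unfolding all by (rule conjunct1)
  ultimately have "f d = a" by blast
  then have "pm_cong p 1 16"
    using ae pm_cong_cancel[OF cop[OF mem(1)], of 1 16] by simp
  then have "int p dvd - 15 \<or> int p dvd 17"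
    by (simp add: pm_cong_def cong_iff_dvd_diff)
  then have "p dvd 15 \<or> p dvd 17"
    by (metis dvd_minus_iff int_dvd_int_iff of_nat_numeral)
  have sum: "int (q a) + int (q b) + int (q c) + int (q d) = int p"
    using total distinct unfolding all by simp
  obtain x where x: "x \<in> {1, -1}" "[int (q a) = x * (8 * int (q d))] (mod int p)"
    using ad unfolding pm_cong_iff_sign by blast
  obtain y where y: "y \<in> {1, -1}" "[int (q b) = y * (4 * int (q d))] (mod int p)"
    using bd unfolding pm_cong_iff_sign by blast
  obtain z where z: "z \<in> {1, -1}" "[int (q c) = z * (2 * int (q d))] (mod int p)"
    using cd unfolding pm_cong_iff_sign by blast
  have "[int (q a) + int (q b) + int (q c) + int (q d)
       = x * (8 * int (q d)) + y * (4 * int (q d)) + z * (2 * int (q d)) + int (q d)] (mod int p)"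
    using x y z by (intro cong_add cong_refl)
  from cong_dvd_iff [OF this]
  have "int p dvd x * (8 * int (q d)) + y * (4 * int (q d)) + z * (2 * int (q d)) + int (q d)"
    unfolding sum by (simp only: dvd_refl)
  also have "\<dots> = (8 * x + 4 * y + 2 * z + 1) * int (q d)" by (simp add: algebra_simps)
  finally have dvd: "int p dvd 8 * x + 4 * y + 2 * z + 1"
    using cop[OF mem(4)] by (simp only: coprime_dvd_mult_left_iff coprime_commute)
  have "\<bar>8 * x + 4 * y + 2 * z + 1\<bar> < 17" "8 * x + 4 * y + 2 * z + 1 \<noteq> 0"
    using x(1) y(1) z(1) by auto
  then have "p \<noteq> 17" using dvd zdvd_imp_le[of 17 "\<bar>8 * x + 4 * y + 2 * z + 1\<bar>"] by auto
  from \<open>p dvd 15 \<or> p dvd 17\<close> show "p = 15"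
  proof
    assume "p dvd 15"
    then obtain m where m: "15 = p * m" by blast
    then have "m < 2" using p mult_le_mono[of 11 p 2 m] by (cases "m < 2") auto
    then show ?thesis using m by (cases m) auto
  next
    assume "p dvd 17"
    then obtain m where m: "17 = p * m" by blast
    then have "m < 2" using p mult_le_mono[of 11 p 2 m] by (cases "m < 2") auto
    then show ?thesis using m \<open>p \<noteq> 17\<close> by (cases m) auto
  qed
qed

theorem theoremA:
  fixes p :: nat and q :: "nat \<Rightarrow> nat" and \<beta> :: "nat \<Rightarrow> real"
  assumes "p > 0"
    and "\<And>i. i \<in> {1..4} \<Longrightarrow> q i > 0"
    and "\<And>i. i \<in> {1..4} \<Longrightarrow> gcd p (q i) = 1"
    and "disjoint_covering_system 4 (\<lambda>i. real p / real (q i)) \<beta>"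
    and "inj_on (\<lambda>i. real p / real (q i)) {1..4}"
  shows "p = 15 \<and> q ` {1..4} = {8, 4, 2, 1}"
proof -
  have ivl: "{1..4::nat} = {1, 2, 3, 4}" by auto
  have less: "q i < p" if "i \<in> {1..4}" for i
    using numerator_bound[OF assms(1,2) _ assms(4) that] by simp
  then have total: "(\<Sum>i\<in>{1..4}. q i) = p"
    by (intro sum_numerators[OF assms(1,2) _ assms(3,4)] less_imp_le)
  then have total': "q 1 + q 2 + q 3 + q 4 = p" unfolding ivl by simp
  have inj: "q i \<noteq> q j" if "i \<in> {1..4}" "j \<in> {1..4}" "i \<noteq> j" for i j
    using inj_onD[OF assms(5) _ that(1,2)] that(3) by auto
  have pos: "0 < q 1" "0 < q 2" "0 < q 3" "0 < q 4" using assms(2) by auto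
  have dist: "q 1 \<noteq> q 2" "q 1 \<noteq> q 3" "q 1 \<noteq> q 4" "q 2 \<noteq> q 3" "q 2 \<noteq> q 4" "q 3 \<noteq> q 4"
    by (rule inj; simp)+
  (* Four distinct positive integers with sum 10 are 1, 2, 3, 4, and 2 is not prime to 10. *)
  have "p \<noteq> 10"
  proof
    assume "p = 10"
    have "q i \<in> {1, 3, 7, 9}" if i: "i \<in> {1..4}" for i
    proof -
      have "q i < 10" using less[OF i] \<open>p = 10\<close> by simp
      then have "q i = 1 \<or> q i = 2 \<or> q i = 3 \<or> q i = 4 \<or> q i = 5 \<or> q i = 6 \<or> q i = 7 \<or> q i = 8 \<or> q i = 9"
        using assms(2)[OF i] by linarith
      moreover have "gcd 10 (q i) = 1" using assms(3)[OF i] \<open>p = 10\<close> by simp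
      ultimately show ?thesis by (elim disjE) (simp_all add: gcd_nat.simps)
    qed
    from this[of 1] this[of 2] this[of 3] this[of 4] show False
      using total' dist \<open>p = 10\<close> by auto
  qed
  moreover have "q 1 + q 2 + q 3 + q 4 \<ge> 10" using pos dist by linarith
  ultimately have p: "p \<ge> 11" using total' by linarith
  have sep: "\<not> pm_cong p (q i) (q j)" if ij: "i \<in> {1..4}" "j \<in> {1..4}" "i \<noteq> j" for i j
  proof (rule not_pm_cong_small)
    have "i = 1 \<or> i = 2 \<or> i = 3 \<or> i = 4" "j = 1 \<or> j = 2 \<or> j = 3 \<or> j = 4" using ij by auto
    then have "q i + q j < p" using total' pos ij(3) by (elim disjE) auto
    then show "int (q i) + int (q j) < int p" by linarith
  qed (use assms(2) inj ij in auto)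
  have "\<exists>f. \<forall>i\<in>{1..4}. f i \<in> {1..4} - {i} \<and> pm_cong p (q i) (2 * int (q (f i)))"
    using exists_doubling_index[OF p assms(2-4) sep] by (intro bchoice) blast
  then obtain f where "\<And>i. i \<in> {1..4} \<Longrightarrow> f i \<in> {1..4} - {i} \<and> pm_cong p (q i) (2 * int (q (f i)))"
    by blast
  moreover have "coprime (int (q i)) (int p)" if "i \<in> {1..4}" for i
    using assms(3)[OF that] by (metis coprime_iff_gcd_eq_1 coprime_int_iff gcd.commute)
  ultimately have "p = 15"
    using doubling_permutation_numerator[OF p _ total sep] by blast
  have residues: "q i \<in> {1, 2, 4, 7, 8}" if i: "i \<in> {1..4}" for i
  proof -
    have "i = 1 \<or> i = 2 \<or> i = 3 \<or> i = 4" using i by auto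
    then have "q i \<le> 9" using total' pos dist \<open>p = 15\<close> by (elim disjE; simp)
    then have "q i = 1 \<or> q i = 2 \<or> q i = 3 \<or> q i = 4 \<or> q i = 5 \<or> q i = 6 \<or> q i = 7 \<or> q i = 8 \<or> q i = 9"
      using assms(2)[OF i] by linarith
    moreover have "gcd 15 (q i) = 1" using assms(3)[OF i] \<open>p = 15\<close> by simp
    ultimately show ?thesis by (elim disjE) (simp_all add: gcd_nat.simps)
  qed
  (* If 7 were present, three of 1, 2, 4, 8 would have the sum 8. *)
  have not_7: "w \<noteq> 7"
    if "w + x + y + z = 15" "x \<noteq> y" "x \<noteq> z" "y \<noteq> z"
      and "x \<in> {1, 2, 4, 7, 8}" "y \<in> {1, 2, 4, 7, 8}" "z \<in> {1, 2, 4, 7, 8}"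
    for w x y z :: nat
    using that by auto
  have "q 1 \<noteq> 7" "q 2 \<noteq> 7" "q 3 \<noteq> 7" "q 4 \<noteq> 7"
    using total' \<open>p = 15\<close> dist residues
    by (intro not_7[of "q 1" "q 2" "q 3" "q 4"] not_7[of "q 2" "q 1" "q 3" "q 4"]
        not_7[of "q 3" "q 1" "q 2" "q 4"] not_7[of "q 4" "q 1" "q 2" "q 3"]; simp)+
  then have "{q 1, q 2, q 3, q 4} \<subseteq> {8, 4, 2, 1}"
    using residues[of 1] residues[of 2] residues[of 3] residues[of 4] by auto
  moreover have "card {q 1, q 2, q 3, q 4} = card {8, 4, 2, 1 :: nat}" using dist by simp
  ultimately have "{q 1, q 2, q 3, q 4} = {8, 4, 2, 1}"
    by (intro card_subset_eq) auto
  then show ?thesis unfolding ivl using \<open>p = 15\<close> by simp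
qed

end
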